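(* Let $r=(r_n)$, $t=(t_n)$ be scalar sequences with $r_n\neq 0$ and $t_n\neq 0$ for all $n\in\mathbb{N}_0$, and let $s=(s_n)$ be a scalar sequence with $s_0\neq 0$. For $x\in w$ put $\mu_k=\frac{1}{r_k}\sum_{i=0}^{k}s_{k-i}t_i\Delta x_i$ for $k\in\mathbb{N}_0$. Define the sequences $b^{(j)}=(b^{(j)}_n)_{n}$, $j\in\mathbb{N}_0$, and $b^{(-1)}=(b^{(-1)}_n)_n$ by $$b_n^{(j)}=\begin{cases}\displaystyle\sum_{k=0}^{n-j}(-1)^k\frac{D_k^{(s)}}{t_{k+j}}r_j & \text{if } 0\le j\le n,\\ 0 & \text{if } j>n,\end{cases}\qquad b_n^{(-1)}=\sum_{j=0}^{n}\sum_{k=0}^{n-j}(-1)^k\frac{D_k^{(s)}}{t_{k+j}}r_j .$$ Then: (i) The sequence $(b^{(j)})_{j=0}^{\infty}$ is a Schauder basis for $c_0(r,s,t;\Delta)$, and every $x\in c_0(r,s,t;\Delta)$ has a unique representation of the form $x=\sum_{j=0}^{\infty}\mu_j b^{(j)}$. (ii) The sequence $(b^{(j)})_{j=-1}^{\infty}$ is a Schauder basis for $c(r,s,t;\Delta)$, and every $x\in c(r,s,t;\Delta)$ has a unique representation of the form $x=\ell\, b^{(-1)}+\sum_{j=0}^{\infty}(\mu_j-\ell)b^{(j)}$, where $\ell=\lim_{n\to\infty}\mu_n$.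
   Context: $\mathbb{N}_0=\{0,1,2,\dots\}$; $w$ is the space of all real (or all complex) sequences $x=(x_n)_{n\in\mathbb{N}_0}$; $c$ and $c_0$ are the spaces of convergent and null sequences. $\Delta x_k=x_k-x_{k-1}$ with $x_{-1}=0$. For $X\in\{c,c_0\}$, $$X(r,s,t;\Delta)=\Big\{x\in w:\Big(\frac{1}{r_n}\sum_{k=0}^{n}s_{n-k}t_k\Delta x_k\Big)_{n}\in X\Big\},$$ normed by $\|x\|=\sup_n\big|\frac{1}{r_n}\sum_{k=0}^{n}s_{n-k}t_k\Delta x_k\big|$. The numbers $D_n^{(s)}$ are: $D_0^{(s)}=1/s_0$, and for $n\ge1$, $D_n^{(s)}=s_0^{-(n+1)}\det M_n$, where $M_n$ is the $n\times n$ matrix whose $(i,j)$ entry ($1\le i,j\le n$) is $s_{i-j+1}$ if $i-j+1\ge 0$ and $0$ otherwise. A sequence $(b_n)$ in a normed space $Y$ is a Schauder basis if for each $x\in Y$ there is a unique sequence of scalars $(\mu_n)$ with $\|x-\sum_{n\le k}\mu_n b_n\|\to0$ as $k\to\infty$. *)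

theory Defs
  imports
    Complex_Main
    "HOL-Library.Function_Algebras"
    "Jordan_Normal_Form.Determinant"
begin

text \<open>
  The spaces considered depend on the sequences \<open>r, s, t\<close>, so they are subspaces of a vector
  space type, with a norm that only matters on the carrier \<open>Y\<close>.
\<close>

locale normed_space_on = vector_space scale
  for scale :: "'k::real_normed_field \<Rightarrow> 'v::ab_group_add \<Rightarrow> 'v" +
  fixes Y :: "'v set" and nrm :: "'v \<Rightarrow> real"
  assumes subspace_carrier: "subspace Y"
    and nrm_eq_0_iff: "x \<in> Y \<Longrightarrow> nrm x = 0 \<longleftrightarrow> x = 0"
    and nrm_scale: "x \<in> Y \<Longrightarrow> nrm (scale a x) = norm a * nrm x"
    and nrm_triangle: "x \<in> Y \<Longrightarrow> y \<in> Y \<Longrightarrow> nrm (x + y) \<le> nrm x + nrm y"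

locale schauder_basis = normed_space_on scale Y nrm
  for scale :: "'k::real_normed_field \<Rightarrow> 'v::ab_group_add \<Rightarrow> 'v"
    and Y :: "'v set" and nrm :: "'v \<Rightarrow> real" +
  fixes b :: "nat \<Rightarrow> 'v"
  assumes basis_in_carrier: "b n \<in> Y"
    and ex1_expansion:
      "x \<in> Y \<Longrightarrow> \<exists>!\<mu>. (\<lambda>k. nrm (x - (\<Sum>n\<le>k. scale (\<mu> n) (b n)))) \<longlonglongrightarrow> 0"

text \<open>
  The space \<open>w\<close> of all sequences is the type \<^typ>\<open>nat \<Rightarrow> 'a\<close> with pointwise operations.
  The class \<^class>\<open>real_normed_field\<close> covers the two intended cases, real and complex scalars.
\<close>

definition seq_scale :: "'a::real_normed_field \<Rightarrow> (nat \<Rightarrow> 'a) \<Rightarrow> nat \<Rightarrow> 'a" where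
  "seq_scale a x = (\<lambda>n. a * x n)"

definition c_seqs :: "(nat \<Rightarrow> 'a::real_normed_field) set" where
  "c_seqs = {x. convergent x}"

definition c0_seqs :: "(nat \<Rightarrow> 'a::real_normed_field) set" where
  "c0_seqs = {x. x \<longlonglongrightarrow> 0}"

definition bdiff :: "(nat \<Rightarrow> 'a::real_normed_field) \<Rightarrow> nat \<Rightarrow> 'a" where
  "bdiff x k = (if k = 0 then x 0 else x k - x (k - 1))"

definition gmean ::
  "(nat \<Rightarrow> 'a::real_normed_field) \<Rightarrow> (nat \<Rightarrow> 'a) \<Rightarrow> (nat \<Rightarrow> 'a) \<Rightarrow> (nat \<Rightarrow> 'a) \<Rightarrow> nat \<Rightarrow> 'a" where
  "gmean r s t x n = 1 / r n * (\<Sum>k=0..n. s (n - k) * t k * bdiff x k)"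

definition gmean_space ::
  "(nat \<Rightarrow> 'a::real_normed_field) set \<Rightarrow> (nat \<Rightarrow> 'a) \<Rightarrow> (nat \<Rightarrow> 'a) \<Rightarrow> (nat \<Rightarrow> 'a) \<Rightarrow> (nat \<Rightarrow> 'a) set"
where
  "gmean_space X r s t = {x. gmean r s t x \<in> X}"

text \<open>
  For \<open>X \<subseteq> c\<close> the set under the supremum is bounded on \<open>gmean_space X r s t\<close>; for other
  sequences the value is meaningless.
\<close>

definition gmean_norm ::
  "(nat \<Rightarrow> 'a::real_normed_field) \<Rightarrow> (nat \<Rightarrow> 'a) \<Rightarrow> (nat \<Rightarrow> 'a) \<Rightarrow> (nat \<Rightarrow> 'a) \<Rightarrow> real" where
  "gmean_norm r s t x = (SUP n. norm (gmean r s t x n))"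

text \<open>
  Matrix indices start at 0 here, which leaves \<open>i - j + 1\<close> unchanged; \<open>j \<le> i + 1\<close> is the
  condition \<open>i - j + 1 \<ge> 0\<close>.
\<close>

definition D_seq :: "(nat \<Rightarrow> 'a::real_normed_field) \<Rightarrow> nat \<Rightarrow> 'a" where
  "D_seq s n =
    (if n = 0 then 1 / s 0
     else inverse (s 0 ^ (n + 1)) *
       det (mat n n (\<lambda>(i, j). if j \<le> i + 1 then s (i + 1 - j) else 0)))"

definition basis_seq ::
  "(nat \<Rightarrow> 'a::real_normed_field) \<Rightarrow> (nat \<Rightarrow> 'a) \<Rightarrow> (nat \<Rightarrow> 'a) \<Rightarrow> nat \<Rightarrow> nat \<Rightarrow> 'a" where
  "basis_seq r s t j n =
    (if j \<le> n then \<Sum>k=0..n - j. (-1) ^ k * (D_seq s k / t (k + j)) * r j else 0)"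

text \<open>The sequence \<open>b\<^sup>(\<^sup>-\<^sup>1\<^sup>)\<close>.\<close>

definition basis_seq_m1 ::
  "(nat \<Rightarrow> 'a::real_normed_field) \<Rightarrow> (nat \<Rightarrow> 'a) \<Rightarrow> (nat \<Rightarrow> 'a) \<Rightarrow> nat \<Rightarrow> 'a" where
  "basis_seq_m1 r s t n =
    (\<Sum>j=0..n. \<Sum>k=0..n - j. (-1) ^ k * (D_seq s k / t (k + j)) * r j)"

end

theory Submission imports Defs begin

text \<open>
  Write \<open>\<mu> = gmean r s t x\<close>. By definition the norm of \<open>x\<close> is the sup norm of \<open>\<mu>\<close>. The map
  \<open>x \<mapsto> \<mu>\<close> is linear, and it is injective: it is the difference operator followed by a lower
  triangular matrix with nonzero diagonal entries \<open>s 0 * t n / r n\<close>. So every claim can be checked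
  on the side of \<open>\<mu>\<close>, for null and convergent sequences with the sup norm.

  The point of the definition of \<open>basis_seq\<close> is that its \<open>j\<close>-th member is sent to the \<open>j\<close>-th unit
  vector (\<open>gmean_basis_seq\<close>), and \<open>basis_seq_m1\<close> to the constant sequence 1
  (\<open>gmean_basis_seq_m1\<close>). This rests on the classical fact that the numbers
  \<open>(-1) ^ k * D_seq s k\<close> are the coefficients of the reciprocal of the power series with
  coefficients \<open>s\<close> (\<open>convolution_D_seq\<close>), which follows by expanding the determinants.

  Let \<open>\<mu>\<close> be convergent. For the expansion with coefficients \<open>\<kappa>\<close> and \<open>\<nu>\<close>, the \<open>k\<close>-th remainder
  is therefore sent to the sequence with entry \<open>\<mu> n - \<kappa> - \<nu> n\<close> for \<open>n \<le> k\<close> and \<open>\<mu> n - \<kappa>\<close> for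
  \<open>n > k\<close>. Every fixed index \<open>n\<close> eventually lies in the first range, where the entry does not
  depend on \<open>k\<close>, so the sup norm of this sequence tends to 0 exactly if all \<open>\<mu> n - \<kappa> - \<nu> n\<close>
  vanish and \<open>\<mu>\<close> converges to \<open>\<kappa>\<close>. This
  equivalence (\<open>expansion_tendsto_iff\<close>) contains existence and uniqueness at once: in
  \<open>c\<close>, \<open>\<kappa>\<close> must be the limit of \<open>\<mu>\<close> and \<open>\<nu>\<close> the difference; for \<open>c0\<close> take \<open>\<kappa> = 0\<close>.
\<close>

section \<open>The determinants as coefficients of a reciprocal power series\<close>

text \<open>
  Leaving the first column \<open>v\<close> free makes the family closed under expansion along the first row:
  the minors are again of this form, with \<open>v\<close> shifted or reset to the shifted \<open>s\<close>.
\<close>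
definition toeplitz_hessenberg :: "(nat \<Rightarrow> 'a::comm_ring_1) \<Rightarrow> (nat \<Rightarrow> 'a) \<Rightarrow> nat \<Rightarrow> 'a mat" where
  "toeplitz_hessenberg s v n =
     mat n n (\<lambda>(i, j). if j = 0 then v i else if j \<le> i + 1 then s (i + 1 - j) else 0)"

abbreviation toeplitz_det :: "(nat \<Rightarrow> 'a::comm_ring_1) \<Rightarrow> nat \<Rightarrow> 'a" where
  "toeplitz_det s n \<equiv> det (toeplitz_hessenberg s (\<lambda>i. s (Suc i)) n)"

text \<open>
  The first row is \<open>v 0, s 0, 0, \<dots>, 0\<close>, so its cofactor expansion has only two terms. Deleting
  column 0 leaves the same Toeplitz pattern; deleting column 1 keeps the rest of \<open>v\<close> as the first
  column.
\<close>
lemma det_toeplitz_hessenberg_Suc_Suc: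
  fixes s :: "nat \<Rightarrow> 'a::comm_ring_1"
  shows "det (toeplitz_hessenberg s v (Suc (Suc n))) =
     v 0 * toeplitz_det s (Suc n) - s 0 * det (toeplitz_hessenberg s (\<lambda>i. v (Suc i)) (Suc n))"
proof -
  let ?A = "toeplitz_hessenberg s v (Suc (Suc n))"
  have A: "?A \<in> carrier_mat (Suc (Suc n)) (Suc (Suc n))"
    by (simp add: toeplitz_hessenberg_def)
  have d0: "mat_delete ?A 0 0 = toeplitz_hessenberg s (\<lambda>i. s (Suc i)) (Suc n)"
    by (rule eq_matI) (auto simp: mat_delete_def toeplitz_hessenberg_def)
  have d1: "mat_delete ?A 0 1 = toeplitz_hessenberg s (\<lambda>i. v (Suc i)) (Suc n)"
    by (rule eq_matI) (auto simp: mat_delete_def toeplitz_hessenberg_def)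
  have "det ?A = (\<Sum>j<Suc (Suc n). ?A $$ (0, j) * cofactor ?A 0 j)"
    by (rule laplace_expansion_row[OF A]) simp
  also have "\<dots> = (\<Sum>j\<in>{0, 1}. ?A $$ (0, j) * cofactor ?A 0 j)"
    by (rule sum.mono_neutral_right) (auto simp: toeplitz_hessenberg_def)
  also have "\<dots> = v 0 * toeplitz_det s (Suc n)
      - s 0 * det (toeplitz_hessenberg s (\<lambda>i. v (Suc i)) (Suc n))"
    unfolding cofactor_def using d0 d1
    by (simp add: toeplitz_hessenberg_def)
  finally show ?thesis .
qed

text \<open>
  For \<open>v i = s (Suc i)\<close> this expresses each \<open>toeplitz_det s\<close> by all the earlier ones, which is the
  recursion for the coefficients of a reciprocal power series.
\<close>
lemma det_toeplitz_hessenberg: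
  fixes s :: "nat \<Rightarrow> 'a::comm_ring_1"
  shows "det (toeplitz_hessenberg s v (Suc n)) =
     (\<Sum>i\<le>n. (- s 0) ^ i * v i * toeplitz_det s (n - i))"
proof (induction n arbitrary: v)
  case 0
  have "det (toeplitz_hessenberg s v (Suc 0)) = v 0"
    by (subst det_single) (auto simp: toeplitz_hessenberg_def)
  moreover have "toeplitz_det s 0 = 1"
    by (rule det_dim_zero) (simp add: toeplitz_hessenberg_def)
  ultimately show ?case by simp
next
  case (Suc n)
  show ?case
    by (simp add: det_toeplitz_hessenberg_Suc_Suc Suc.IH sum.atMost_Suc_shift[of _ n]
        sum_distrib_left sum_negf[symmetric] mult.assoc del: sum.atMost_Suc)
qed

text \<open>The separate value at 0 in the definition agrees with the empty determinant being 1.\<close>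
lemma D_seq_eq_toeplitz_det:
  fixes s :: "nat \<Rightarrow> 'a::real_normed_field"
  shows "D_seq s n = toeplitz_det s n / s 0 ^ Suc n"
proof (cases n)
  case 0
  have "toeplitz_det s 0 = 1"
    by (rule det_dim_zero) (simp add: toeplitz_hessenberg_def)
  with 0 show ?thesis by (simp add: D_seq_def)
next
  case (Suc m)
  have "mat n n (\<lambda>(i, j). if j \<le> i + 1 then s (i + 1 - j) else 0) =
      toeplitz_hessenberg s (\<lambda>i. s (Suc i)) n"
    by (rule eq_matI) (auto simp: toeplitz_hessenberg_def)
  with Suc show ?thesis by (simp add: D_seq_def divide_inverse mult.commute)
qed

text \<open>
  As formal power series, \<open>\<Sum>k. (-1) ^ k * D_seq s k * X ^ k\<close> is the reciprocal of
  \<open>\<Sum>k. s k * X ^ k\<close>. For positive \<open>n\<close>, the terms with \<open>k < n\<close> add up, by the determinant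
  recursion, to the negative of the term with \<open>k = n\<close>.
\<close>
lemma convolution_D_seq:
  fixes s :: "nat \<Rightarrow> 'a::real_normed_field"
  assumes "s 0 \<noteq> 0"
  shows "(\<Sum>k\<le>n. s (n - k) * ((-1) ^ k * D_seq s k)) = (if n = 0 then 1 else 0)"
proof (cases n)
  case 0
  with assms show ?thesis by (simp add: D_seq_def)
next
  case (Suc m)
  let ?P = "toeplitz_det s"
  have "(\<Sum>k\<le>m. s (Suc m - k) * ((-1) ^ k * D_seq s k)) =
      (\<Sum>i\<le>m. s (Suc i) * ((-1) ^ (m - i) * D_seq s (m - i)))"
    by (subst sum.nat_diff_reindex[of _ "Suc m", unfolded lessThan_Suc_atMost, symmetric])
      (auto intro!: sum.cong simp: Suc_diff_le)
  also have "\<dots> = (\<Sum>i\<le>m. (-1) ^ m / s 0 ^ Suc m * ((- s 0) ^ i * s (Suc i) * ?P (m - i)))"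
  proof (rule sum.cong)
    fix i assume "i \<in> {..m}"
    then obtain d where d: "m = i + d" by (metis atMost_iff le_Suc_ex)
    \<comment> \<open>The substitution \<open>k = m - i\<close> leaves \<open>d = m - i\<close>; the surplus sign and power of \<open>s 0\<close>, both
      of exponent \<open>i\<close>, are absorbed by \<open>(- s 0) ^ i\<close>.\<close>
    have sign: "(-1) ^ m * (- s 0) ^ i = s 0 ^ i * (-1) ^ d"
      by (simp add: d power_add power_minus[of "s 0" i] ac_simps)
    have "(-1) ^ m / s 0 ^ Suc m * ((- s 0) ^ i * s (Suc i) * ?P (m - i)) =
        ((-1) ^ m * (- s 0) ^ i) * (s (Suc i) * ?P (m - i)) / s 0 ^ Suc m"
      by (simp only: times_divide_eq_left mult.assoc)
    also have "\<dots> = (s 0 ^ i * ((-1) ^ d * (s (Suc i) * ?P d))) / (s 0 ^ i * s 0 ^ Suc d)"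
      unfolding sign by (simp add: d power_add mult.assoc mult.left_commute)
    also have "\<dots> = s (Suc i) * ((-1) ^ (m - i) * D_seq s (m - i))"
      using assms by (simp add: d D_seq_eq_toeplitz_det mult.left_commute)
    finally show "s (Suc i) * ((-1) ^ (m - i) * D_seq s (m - i)) =
        (-1) ^ m / s 0 ^ Suc m * ((- s 0) ^ i * s (Suc i) * ?P (m - i))" ..
  qed simp
  also have "\<dots> = (-1) ^ m / s 0 ^ Suc m * ?P (Suc m)"
    by (simp only: det_toeplitz_hessenberg sum_distrib_left)
  finally show ?thesis
    using assms Suc by (simp add: D_seq_eq_toeplitz_det)
qed

section \<open>The generalized mean as an injective linear map\<close>

lemma sum_fun_apply: "(\<Sum>i\<in>A. f i) x = (\<Sum>i\<in>A. f i x)"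
  for f :: "'i \<Rightarrow> 'b \<Rightarrow> 'c::comm_monoid_add"
  by (induction A rule: infinite_finite_induct) auto

lemma bdiff_zero: "bdiff 0 k = 0"
  by (simp add: bdiff_def zero_fun_def)

lemma bdiff_add: "bdiff (x + y) k = bdiff x k + bdiff y k"
  by (simp add: bdiff_def)

lemma gmean_add: "gmean r s t (x + y) = gmean r s t x + gmean r s t y"
  by (rule ext) (simp add: gmean_def bdiff_add distrib_left sum.distrib add_divide_distrib)

lemma gmean_scale: "gmean r s t (seq_scale a x) = seq_scale a (gmean r s t x)"
  by (rule ext) (simp add: gmean_def bdiff_def seq_scale_def sum_distrib_left, rule sum.cong,
      auto simp: algebra_simps)

lemma gmean_zero: "gmean r s t 0 = 0"
  by (rule ext) (simp add: gmean_def bdiff_zero)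

lemma gmean_diff: "gmean r s t (x - y) = gmean r s t x - gmean r s t y"
  using gmean_add[of r s t "x - y" y] by (simp add: algebra_simps)

lemma gmean_sum: "gmean r s t (\<Sum>i\<in>A. f i) = (\<Sum>i\<in>A. gmean r s t (f i))"
  by (induction A rule: infinite_finite_induct) (simp_all only: sum.infinite sum.empty sum.insert
      gmean_zero gmean_add not_False_eq_True)

text \<open>
  Locality of the mean: it permits replacing \<open>basis_seq_m1\<close>, a sum of more and more basis sequences
  as the index grows, by a single finite sum.
\<close>
lemma gmean_cong:
  assumes "\<And>m. m \<le> n \<Longrightarrow> x m = y m"
  shows "gmean r s t x n = gmean r s t y n"
  unfolding gmean_def using assms by (auto intro!: sum.cong simp: bdiff_def)

locale nonvanishing_weights =
  fixes r s t :: "nat \<Rightarrow> 'a::real_normed_field"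
  assumes r_nz: "r n \<noteq> 0" and t_nz: "t n \<noteq> 0" and s_nz: "s 0 \<noteq> 0"

text \<open>
  Forward substitution: once the earlier differences of \<open>x\<close> vanish, the \<open>n\<close>-th mean is a nonzero
  multiple of the \<open>n\<close>-th difference.
\<close>
lemma (in nonvanishing_weights) gmean_eq_0_imp_eq_0:
  assumes zero: "gmean r s t x = 0"
  shows "x = 0"
proof
  fix n
  show "x n = 0 n"
  proof (induction n rule: less_induct)
    case (less n)
    have "bdiff x k = 0" if "k < n" for k
      using less that by (simp add: bdiff_def)
    then have "(\<Sum>k=0..n. s (n - k) * t k * bdiff x k) = (\<Sum>k\<in>{n}. s (n - k) * t k * bdiff x k)"
      by (intro sum.mono_neutral_right) auto
    then have "gmean r s t x n = 1 / r n * (s 0 * t n * bdiff x n)"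
      by (simp add: gmean_def)
    with zero r_nz t_nz s_nz have "bdiff x n = 0" by simp
    with less show ?case by (cases n) (simp_all add: bdiff_def)
  qed
qed

section \<open>Images of the basis sequences\<close>

text \<open>
  The entries of \<open>basis_seq\<close> are partial sums, so differencing recovers the single summands. The
  division by \<open>t m\<close> is there to cancel the factor \<open>t m\<close> in the mean.
\<close>
lemma bdiff_basis_seq:
  "bdiff (basis_seq r s t j) m =
     (if j \<le> m then (-1) ^ (m - j) * (D_seq s (m - j) / t m) * r j else 0)"
proof (cases "j < m")
  case True
  then have "m - j = Suc (m - 1 - j)" by simp
  with True show ?thesis by (simp add: bdiff_def basis_seq_def)
next
  case False
  then show ?thesis by (auto simp: bdiff_def basis_seq_def)
qed

text \<open>
  After the cancellation of \<open>t\<close> the mean is the convolution of \<open>s\<close> with its reciprocal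
  coefficients, started at index \<open>j\<close>, times \<open>r j / r n\<close>.
\<close>
lemma (in nonvanishing_weights) gmean_basis_seq:
  "gmean r s t (basis_seq r s t j) = (\<lambda>n. if n = j then 1 else 0)"
proof
  fix n
  let ?f = "\<lambda>m. s (n - m) * t m * bdiff (basis_seq r s t j) m"
  show "gmean r s t (basis_seq r s t j) n = (if n = j then 1 else 0)"
  proof (cases "j \<le> n")
    case True
    then obtain d where d: "n = d + j" by (metis add.commute le_Suc_ex)
    have "(\<Sum>m=0..n. ?f m) = (\<Sum>m=0+j..d+j. ?f m)"
      by (rule sum.mono_neutral_right) (auto simp: d bdiff_basis_seq)
    also have "\<dots> = (\<Sum>k\<le>d. ?f (k + j))"
      unfolding sum.shift_bounds_cl_nat_ivl by (simp add: atLeast0AtMost)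
    also have "\<dots> = (\<Sum>k\<le>d. s (d - k) * ((-1) ^ k * D_seq s k)) * r j"
      by (simp add: sum_distrib_right, rule sum.cong) (simp_all add: d bdiff_basis_seq t_nz)
    finally show ?thesis
      by (simp add: gmean_def d convolution_D_seq[of s, OF s_nz] r_nz)
  next
    case False
    then show ?thesis by (auto simp: gmean_def bdiff_basis_seq intro!: sum.neutral)
  qed
qed

text \<open>
  Since \<open>basis_seq r s t j\<close> vanishes before index \<open>j\<close>, the sequence \<open>basis_seq_m1 r s t\<close> is the
  pointwise sum of all basis sequences, and its mean is the sum of all unit vectors.
\<close>
lemma (in nonvanishing_weights) gmean_basis_seq_m1:
  "gmean r s t (basis_seq_m1 r s t) = (\<lambda>_. 1)"
proof
  fix n
  have "basis_seq_m1 r s t m = (\<Sum>j\<le>n. basis_seq r s t j) m" if "m \<le> n" for m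
  proof -
    have "basis_seq_m1 r s t m = (\<Sum>j\<le>m. basis_seq r s t j m)"
      by (simp add: basis_seq_m1_def basis_seq_def atLeast0AtMost)
    also have "\<dots> = (\<Sum>j\<le>n. basis_seq r s t j m)"
      using that by (intro sum.mono_neutral_left) (auto simp: basis_seq_def)
    finally show ?thesis by (simp add: sum_fun_apply)
  qed
  then have "gmean r s t (basis_seq_m1 r s t) n = gmean r s t (\<Sum>j\<le>n. basis_seq r s t j) n"
    by (rule gmean_cong)
  also have "\<dots> = 1"
    by (simp add: gmean_sum sum_fun_apply gmean_basis_seq)
  finally show "gmean r s t (basis_seq_m1 r s t) n = 1" .
qed

section \<open>The normed spaces\<close>

lemma norm_le_SUP_norm:
  assumes "Bseq x"
  shows "norm (x n) \<le> (SUP n. norm (x n))"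
  using assms by (intro cSUP_upper) (auto intro: bdd_aboveI2 elim!: BseqE)

lemma vector_space_seq_scale: "vector_space (seq_scale :: 'a::real_normed_field \<Rightarrow> _)"
  by unfold_locales (auto simp: seq_scale_def algebra_simps)

text \<open>
  Pulling the sup norm back along a linear map always gives a seminorm; injectivity of the mean
  makes it a norm.
\<close>
lemma (in nonvanishing_weights) normed_space_on_gmean_space:
  assumes X: "module.subspace seq_scale X" "X \<subseteq> c_seqs"
  shows "normed_space_on seq_scale (gmean_space X r s t) (gmean_norm r s t)"
proof -
  interpret vector_space "seq_scale :: 'a \<Rightarrow> _" by (rule vector_space_seq_scale)
  let ?G = "gmean r s t"
  have le: "norm (?G x n) \<le> gmean_norm r s t x" if "x \<in> gmean_space X r s t" for x n
    unfolding gmean_norm_def using that X(2)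
    by (intro norm_le_SUP_norm convergent_imp_Bseq) (auto simp: gmean_space_def c_seqs_def)
  show ?thesis
  proof
    show "subspace (gmean_space X r s t)"
      using X(1) by (auto simp: subspace_def gmean_space_def gmean_zero gmean_add gmean_scale)
  next
    fix x assume x: "x \<in> gmean_space X r s t"
    show "gmean_norm r s t x = 0 \<longleftrightarrow> x = 0"
    proof
      assume "gmean_norm r s t x = 0"
      with le[OF x] have "?G x = 0" by (auto intro!: ext)
      then show "x = 0" by (rule gmean_eq_0_imp_eq_0)
    qed (simp add: gmean_norm_def gmean_zero)
  next
    fix x and a :: 'a assume x: "x \<in> gmean_space X r s t"
    have eq: "norm (?G (seq_scale a x) n) = norm a * norm (?G x n)" for n
      unfolding gmean_scale by (simp add: seq_scale_def norm_mult)
    show "gmean_norm r s t (seq_scale a x) = norm a * gmean_norm r s t x"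
    proof (cases "a = 0")
      case False
      have ax: "seq_scale a x \<in> gmean_space X r s t"
        using x X(1) by (auto simp: subspace_def gmean_space_def gmean_scale)
      have "gmean_norm r s t (seq_scale a x) \<le> norm a * gmean_norm r s t x"
        using le[OF x] unfolding gmean_norm_def[of _ _ _ "seq_scale a x"]
        by (intro cSUP_least) (simp_all add: eq mult_left_mono)
      moreover have "gmean_norm r s t x \<le> gmean_norm r s t (seq_scale a x) / norm a"
        using le[OF ax] False unfolding gmean_norm_def[of _ _ _ x]
        by (intro cSUP_least) (simp_all add: eq pos_le_divide_eq mult.commute)
      ultimately show ?thesis using False by (simp add: pos_le_divide_eq mult.commute)
    qed (simp add: gmean_norm_def gmean_zero)
  next
    fix x y assume x: "x \<in> gmean_space X r s t" and y: "y \<in> gmean_space X r s t"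
    show "gmean_norm r s t (x + y) \<le> gmean_norm r s t x + gmean_norm r s t y"
      unfolding gmean_norm_def[of _ _ _ "x + y"]
    proof (rule cSUP_least)
      fix n
      have "norm (?G (x + y) n) \<le> norm (?G x n) + norm (?G y n)"
        by (simp add: gmean_add norm_triangle_ineq)
      also have "\<dots> \<le> gmean_norm r s t x + gmean_norm r s t y"
        by (intro add_mono le x y)
      finally show "norm (?G (x + y) n) \<le> gmean_norm r s t x + gmean_norm r s t y" .
    qed simp
  qed
qed

lemma subspace_c_seqs: "module.subspace seq_scale (c_seqs :: (nat \<Rightarrow> 'a::real_normed_field) set)"
proof -
  interpret vector_space "seq_scale :: 'a \<Rightarrow> _" by (rule vector_space_seq_scale)
  show ?thesis
    by (auto simp: subspace_def c_seqs_def seq_scale_def plus_fun_def zero_fun_def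
        intro: convergent_add convergent_mult convergent_const)
qed

lemma subspace_c0_seqs: "module.subspace seq_scale (c0_seqs :: (nat \<Rightarrow> 'a::real_normed_field) set)"
proof -
  interpret vector_space "seq_scale :: 'a \<Rightarrow> _" by (rule vector_space_seq_scale)
  show ?thesis
    by (auto simp: subspace_def c0_seqs_def seq_scale_def plus_fun_def zero_fun_def
        intro: tendsto_add_zero tendsto_mult_right_zero)
qed

lemma c0_seqs_subset_c_seqs: "c0_seqs \<subseteq> c_seqs"
  by (auto simp: c0_seqs_def c_seqs_def convergent_def)

section \<open>Convergence of expansions\<close>

text \<open>
  The values \<open>a n\<close> stay put once \<open>k \<ge> n\<close>, so a supremum tending to 0 forces them to be 0. At
  \<open>n = Suc k\<close> the supremum bounds \<open>d (Suc k)\<close>, which forces \<open>d\<close> to be a null sequence.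
  Conversely, with \<open>a = 0\<close> only the tail of \<open>d\<close> beyond \<open>k\<close> contributes.
\<close>
lemma SUP_norm_spliced_tendsto_0_iff:
  fixes a d :: "nat \<Rightarrow> 'a::real_normed_vector"
  assumes "Bseq d"
  shows "(\<lambda>k. SUP n. norm (if n \<le> k then a n else d n)) \<longlonglongrightarrow> 0 \<longleftrightarrow> (\<forall>n. a n = 0) \<and> d \<longlonglongrightarrow> 0"
    (is "?S \<longlonglongrightarrow> 0 \<longleftrightarrow> _")
proof
  assume lim: "?S \<longlonglongrightarrow> 0"
  have le: "norm (if n \<le> k then a n else d n) \<le> ?S k" for n k
  proof (rule norm_le_SUP_norm)
    show "Bseq (\<lambda>n. if n \<le> k then a n else d n)"
      using assms by (rule Bseq_eventually_mono[rotated])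
        (auto simp: eventually_sequentially intro!: exI[of _ "Suc k"])
  qed
  have "a n = 0" for n
  proof -
    have "norm (a n) \<le> ?S k" if "k \<ge> n" for k
      using le[of n k] that by simp
    then have "eventually (\<lambda>k. norm (a n) \<le> ?S k) sequentially"
      by (auto simp: eventually_sequentially)
    with lim have "norm (a n) \<le> 0"
      by (rule tendsto_lowerbound) simp
    then show ?thesis by simp
  qed
  moreover have "d \<longlonglongrightarrow> 0"
  proof -
    have "norm (d (Suc k)) \<le> ?S k" for k
      using le[of "Suc k" k] by simp
    then have "(\<lambda>k. norm (d (Suc k))) \<longlonglongrightarrow> 0"
      by (intro tendsto_sandwich[OF _ _ tendsto_const lim]) auto
    then have "(\<lambda>k. d (Suc k)) \<longlonglongrightarrow> 0"
      by (rule tendsto_norm_zero_cancel)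
    then show ?thesis by (simp add: filterlim_sequentially_Suc)
  qed
  ultimately show "(\<forall>n. a n = 0) \<and> d \<longlonglongrightarrow> 0" by blast
next
  assume rhs: "(\<forall>n. a n = 0) \<and> d \<longlonglongrightarrow> 0"
  show "?S \<longlonglongrightarrow> 0"
  proof (rule LIMSEQ_I)
    fix e :: real assume "e > 0"
    then obtain N where N: "\<And>n. n \<ge> N \<Longrightarrow> norm (d n) < e / 2"
      using rhs LIMSEQ_D[of d 0 "e / 2"] by auto
    have "norm (?S k - 0) < e" if "k \<ge> N" for k
    proof -
      have b: "norm (if n \<le> k then a n else d n) \<le> e / 2" for n
        using rhs N[of n] that \<open>e > 0\<close> by auto
      have "0 \<le> norm (if 0 \<le> k then a 0 else d 0)" by simp
      also have "\<dots> \<le> ?S k"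
        by (rule cSUP_upper) (auto intro!: bdd_aboveI2[OF b])
      finally have "0 \<le> ?S k" .
      moreover have "?S k \<le> e / 2" by (rule cSUP_least) (use b in auto)
      ultimately show ?thesis using \<open>e > 0\<close> by simp
    qed
    then show "\<exists>N. \<forall>k\<ge>N. norm (?S k - 0) < e" by blast
  qed
qed

text \<open>
  The mean of the remainder is a spliced sequence, since the \<open>k\<close>-th partial sum only changes the
  coordinates up to \<open>k\<close>.
\<close>
lemma (in nonvanishing_weights) expansion_tendsto_iff:
  assumes conv: "convergent (gmean r s t x)"
  shows "(\<lambda>k. gmean_norm r s t
            (x - (seq_scale \<kappa> (basis_seq_m1 r s t) +
                  (\<Sum>j\<le>k. seq_scale (\<nu> j) (basis_seq r s t j))))) \<longlonglongrightarrow> 0 \<longleftrightarrow>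
         gmean r s t x \<longlonglongrightarrow> \<kappa> \<and> \<nu> = (\<lambda>j. gmean r s t x j - \<kappa>)"
proof -
  let ?mu = "gmean r s t x"
  have "gmean r s t (x - (seq_scale \<kappa> (basis_seq_m1 r s t) +
            (\<Sum>j\<le>k. seq_scale (\<nu> j) (basis_seq r s t j)))) n =
        (if n \<le> k then ?mu n - \<kappa> - \<nu> n else ?mu n - \<kappa>)" for k n
    unfolding gmean_diff gmean_add gmean_sum gmean_scale gmean_basis_seq gmean_basis_seq_m1
    by (simp add: seq_scale_def sum_fun_apply if_distrib sum.delta cong: if_cong)
  moreover have "Bseq (\<lambda>n. ?mu n - \<kappa>)"
    using conv by (intro convergent_imp_Bseq convergent_diff convergent_const)
  ultimately show ?thesis
    by (auto simp: gmean_norm_def SUP_norm_spliced_tendsto_0_iff LIM_zero_iff fun_eq_iff)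
qed

lemma (in nonvanishing_weights) expansion_tendsto_iff_c0:
  assumes x: "x \<in> gmean_space c0_seqs r s t"
  shows "(\<lambda>k. gmean_norm r s t (x - (\<Sum>j\<le>k. seq_scale (\<nu> j) (basis_seq r s t j)))) \<longlonglongrightarrow> 0 \<longleftrightarrow>
         \<nu> = gmean r s t x"
proof -
  have lim: "gmean r s t x \<longlonglongrightarrow> 0"
    using x by (simp add: gmean_space_def c0_seqs_def)
  have "seq_scale 0 (basis_seq_m1 r s t) = 0"
    by (auto simp: seq_scale_def)
  with expansion_tendsto_iff[OF convergentI[OF lim], where \<kappa> = 0 and \<nu> = \<nu>] lim
  show ?thesis by simp
qed

lemma (in nonvanishing_weights) schauder_basis_gmean_c0:
  "schauder_basis seq_scale (gmean_space c0_seqs r s t) (gmean_norm r s t) (basis_seq r s t)"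
proof (rule schauder_basis.intro)
  show "normed_space_on seq_scale (gmean_space c0_seqs r s t) (gmean_norm r s t)"
    by (rule normed_space_on_gmean_space[OF subspace_c0_seqs c0_seqs_subset_c_seqs])
  show "schauder_basis_axioms seq_scale (gmean_space c0_seqs r s t) (gmean_norm r s t)
      (basis_seq r s t)"
  proof
    fix j
    have "(\<lambda>n. if n = j then 1 else 0 :: 'a) \<longlonglongrightarrow> 0"
      by (rule tendsto_eventually) (auto simp: eventually_sequentially intro!: exI[of _ "Suc j"])
    then show "basis_seq r s t j \<in> gmean_space c0_seqs r s t"
      by (simp add: gmean_space_def c0_seqs_def gmean_basis_seq)
  qed (simp add: expansion_tendsto_iff_c0)
qed

lemma (in nonvanishing_weights) schauder_basis_gmean_c:
  "schauder_basis seq_scale (gmean_space c_seqs r s t) (gmean_norm r s t)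
           (case_nat (basis_seq_m1 r s t) (basis_seq r s t))"
proof (rule schauder_basis.intro)
  show "normed_space_on seq_scale (gmean_space c_seqs r s t) (gmean_norm r s t)"
    by (rule normed_space_on_gmean_space[OF subspace_c_seqs subset_refl])
  show "schauder_basis_axioms seq_scale (gmean_space c_seqs r s t) (gmean_norm r s t)
      (case_nat (basis_seq_m1 r s t) (basis_seq r s t))"
  proof
    fix j
    have "convergent (\<lambda>n. if n = i then 1 else 0 :: 'a)" for i
      by (rule convergentI[of _ 0], rule tendsto_eventually)
        (auto simp: eventually_sequentially intro!: exI[of _ "Suc i"])
    then show "case_nat (basis_seq_m1 r s t) (basis_seq r s t) j \<in> gmean_space c_seqs r s t"
      by (simp add: gmean_space_def c_seqs_def gmean_basis_seq gmean_basis_seq_m1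
          convergent_const split: nat.split)
  next
    fix x assume "x \<in> gmean_space c_seqs r s t"
    then have conv: "convergent (gmean r s t x)" by (simp add: gmean_space_def c_seqs_def)
    then obtain l where l: "gmean r s t x \<longlonglongrightarrow> l" by (auto simp: convergent_def)
    let ?b = "case_nat (basis_seq_m1 r s t) (basis_seq r s t)"
    let ?R = "\<lambda>\<mu> k. gmean_norm r s t (x - (\<Sum>n\<le>k. seq_scale (\<mu> n) (?b n)))"
    have iff: "?R \<mu> \<longlonglongrightarrow> 0 \<longleftrightarrow> \<mu> = case_nat l (\<lambda>j. gmean r s t x j - l)" for \<mu>
    proof -
      \<comment> \<open>The combined basis starts with \<open>basis_seq_m1\<close>, so its partial sum up to \<open>Suc k\<close> contains
        the basis sequences up to \<open>k\<close>.\<close>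
      have "?R \<mu> \<longlonglongrightarrow> 0 \<longleftrightarrow> (\<lambda>k. ?R \<mu> (Suc k)) \<longlonglongrightarrow> 0"
        by (rule filterlim_sequentially_Suc[symmetric])
      also have "\<dots> \<longleftrightarrow> gmean r s t x \<longlonglongrightarrow> \<mu> 0 \<and> (\<lambda>j. \<mu> (Suc j)) = (\<lambda>j. gmean r s t x j - \<mu> 0)"
        unfolding sum.atMost_Suc_shift nat.case by (rule expansion_tendsto_iff[OF conv])
      also have "\<dots> \<longleftrightarrow> \<mu> = case_nat l (\<lambda>j. gmean r s t x j - l)"
      proof
        assume *: "gmean r s t x \<longlonglongrightarrow> \<mu> 0 \<and> (\<lambda>j. \<mu> (Suc j)) = (\<lambda>j. gmean r s t x j - \<mu> 0)"
        with l have \<mu>0: "\<mu> 0 = l" by (blast intro: LIMSEQ_unique)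
        have \<mu>Suc: "\<mu> (Suc j) = gmean r s t x j - \<mu> 0" for j
          using fun_cong[OF conjunct2[OF *]] .
        show "\<mu> = case_nat l (\<lambda>j. gmean r s t x j - l)"
        proof
          fix n
          show "\<mu> n = case_nat l (\<lambda>j. gmean r s t x j - l) n"
            by (cases n) (simp_all add: \<mu>0 \<mu>Suc)
        qed
      next
        assume "\<mu> = case_nat l (\<lambda>j. gmean r s t x j - l)"
        with l show "gmean r s t x \<longlonglongrightarrow> \<mu> 0 \<and> (\<lambda>j. \<mu> (Suc j)) = (\<lambda>j. gmean r s t x j - \<mu> 0)"
          by simp
      qed
      finally show ?thesis .
    qed
    then show "\<exists>!\<mu>. ?R \<mu> \<longlonglongrightarrow> 0" by simp
  qed
qed

theorem theorem4p3:
  fixes r s t :: "nat \<Rightarrow> 'a::real_normed_field"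
  assumes "\<And>n. r n \<noteq> 0" and "\<And>n. t n \<noteq> 0" and "s 0 \<noteq> 0"
  shows
    "(schauder_basis seq_scale (gmean_space c0_seqs r s t) (gmean_norm r s t) (basis_seq r s t) \<and>
      (\<forall>x \<in> gmean_space c0_seqs r s t.
        (\<lambda>k. gmean_norm r s t
               (x - (\<Sum>j\<le>k. seq_scale (gmean r s t x j) (basis_seq r s t j)))) \<longlonglongrightarrow> 0 \<and>
        (\<forall>\<nu>. (\<lambda>k. gmean_norm r s t
                     (x - (\<Sum>j\<le>k. seq_scale (\<nu> j) (basis_seq r s t j)))) \<longlonglongrightarrow> 0
              \<longrightarrow> \<nu> = gmean r s t x))) \<and>
     (schauder_basis seq_scale (gmean_space c_seqs r s t) (gmean_norm r s t)
        (case_nat (basis_seq_m1 r s t) (basis_seq r s t)) \<and>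
      (\<forall>x \<in> gmean_space c_seqs r s t. \<exists>l. gmean r s t x \<longlonglongrightarrow> l \<and>
        (\<lambda>k. gmean_norm r s t
               (x - (seq_scale l (basis_seq_m1 r s t) +
                     (\<Sum>j\<le>k. seq_scale (gmean r s t x j - l) (basis_seq r s t j))))) \<longlonglongrightarrow> 0 \<and>
        (\<forall>\<kappa> \<nu>. (\<lambda>k. gmean_norm r s t
                     (x - (seq_scale \<kappa> (basis_seq_m1 r s t) +
                           (\<Sum>j\<le>k. seq_scale (\<nu> j) (basis_seq r s t j))))) \<longlonglongrightarrow> 0
              \<longrightarrow> \<kappa> = l \<and> \<nu> = (\<lambda>j. gmean r s t x j - l))))"
proof -
  interpret nonvanishing_weights r s t
    by unfold_locales (fact assms)+
  show ?thesis
  proof (intro conjI ballI)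
    show "schauder_basis seq_scale (gmean_space c0_seqs r s t) (gmean_norm r s t) (basis_seq r s t)"
      by (rule schauder_basis_gmean_c0)
    show "schauder_basis seq_scale (gmean_space c_seqs r s t) (gmean_norm r s t)
          (case_nat (basis_seq_m1 r s t) (basis_seq r s t))"
      by (rule schauder_basis_gmean_c)
  next
    fix x assume "x \<in> gmean_space c0_seqs r s t"
    note iff = expansion_tendsto_iff_c0[OF this]
    show "(\<lambda>k. gmean_norm r s t
            (x - (\<Sum>j\<le>k. seq_scale (gmean r s t x j) (basis_seq r s t j)))) \<longlonglongrightarrow> 0"
      by (simp add: iff)
    show "\<forall>\<nu>. (\<lambda>k. gmean_norm r s t
            (x - (\<Sum>j\<le>k. seq_scale (\<nu> j) (basis_seq r s t j)))) \<longlonglongrightarrow> 0 \<longrightarrow> \<nu> = gmean r s t x"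
      by (simp add: iff)
  next
    fix x assume "x \<in> gmean_space c_seqs r s t"
    then have conv: "convergent (gmean r s t x)" by (simp add: gmean_space_def c_seqs_def)
    then obtain l where l: "gmean r s t x \<longlonglongrightarrow> l" by (auto simp: convergent_def)
    show "\<exists>l. gmean r s t x \<longlonglongrightarrow> l \<and>
          (\<lambda>k. gmean_norm r s t
                 (x - (seq_scale l (basis_seq_m1 r s t) +
                       (\<Sum>j\<le>k. seq_scale (gmean r s t x j - l) (basis_seq r s t j))))) \<longlonglongrightarrow> 0 \<and>
          (\<forall>\<kappa> \<nu>. (\<lambda>k. gmean_norm r s t
                       (x - (seq_scale \<kappa> (basis_seq_m1 r s t) +
                             (\<Sum>j\<le>k. seq_scale (\<nu> j) (basis_seq r s t j))))) \<longlonglongrightarrow> 0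
                \<longrightarrow> \<kappa> = l \<and> \<nu> = (\<lambda>j. gmean r s t x j - l))"
      unfolding expansion_tendsto_iff[OF conv]
    proof (intro exI[of _ l] conjI allI impI)
      fix \<kappa> \<nu> assume *: "gmean r s t x \<longlonglongrightarrow> \<kappa> \<and> \<nu> = (\<lambda>j. gmean r s t x j - \<kappa>)"
      with l show "\<kappa> = l" by (blast intro: LIMSEQ_unique)
      with * show "\<nu> = (\<lambda>j. gmean r s t x j - l)" by simp
    qed (rule l refl)+
  qed
qed

end
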